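(* Let $H(\Gamma_n)$ denote the eigentime identity for random walks on the $n$-cube $\Gamma_n$. Then $$\lim_{n\to\infty}\frac{H(\Gamma_n)}{2^n} = 1.$$
   Context: For $n\ge 1$, let $G_n = \mathbb{Z}_2^n$ and $S_n = \{(x_1,\dots,x_n)\in G_n : \text{exactly one } x_i \text{ equals } 1\}$. The $n$-cube $\Gamma_n = \mathrm{Cay}(G_n,S_n)$ is the simple undirected graph with vertex set $G_n$ in which $g$ and $g'$ are adjacent iff $g' = g+s$ for some $s\in S_n$; it is connected, has $2^n$ vertices and is $n$-regular. For a finite connected simple graph $\Gamma$ with vertices $1,\dots,N$ and edge set $E(\Gamma)$, consider the simple random walk (at each step move to a uniformly random neighbour). Let $H_{ij}$ be the mean first-passage time from $i$ to $j$, i.e. the expected number of steps for a walk started at $i$ to arrive at $j$ for the first time, with $H_{jj}=0$. Let $\pi_j = d_j/(2|E(\Gamma)|)$ be the stationary distribution, where $d_j$ is the degree of $j$. The eigentime identity for random walks on $\Gamma$ is the number $H(\Gamma) = \sum_{j=1}^{N}\pi_j H_{ij}$, which is independent of the starting vertex $i$. *)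

theory Defs
  imports "HOL-Probability.Probability" "HOL-Algebra.Algebra"
begin

text \<open>A simple graph is given by its vertices and its edges, the latter being two-element sets of
  vertices.\<close>

record 'a sgraph =
  verts :: "'a set"
  edges :: "'a set set"

definition nbrs :: "'a sgraph \<Rightarrow> 'a \<Rightarrow> 'a set" where
  "nbrs \<Gamma> v = {w \<in> verts \<Gamma>. {v, w} \<in> edges \<Gamma>}"

definition vertex_degree :: "'a sgraph \<Rightarrow> 'a \<Rightarrow> nat" where
  "vertex_degree \<Gamma> v = card (nbrs \<Gamma> v)"

definition cayley_graph :: "('a, 'b) monoid_scheme \<Rightarrow> 'a set \<Rightarrow> 'a sgraph" where
  "cayley_graph G S =
     \<lparr>verts = carrier G, edges = {{g, g \<otimes>\<^bsub>G\<^esub> s} | g s. g \<in> carrier G \<and> s \<in> S}\<rparr>"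

definition cube_group :: "nat \<Rightarrow> (nat \<Rightarrow> int) monoid" where
  "cube_group n = product_group {1..n} (\<lambda>_. integer_mod_group 2)"

definition cube_gens :: "nat \<Rightarrow> (nat \<Rightarrow> int) set" where
  "cube_gens n = {x \<in> carrier (cube_group n). \<exists>!i. i \<in> {1..n} \<and> x i = 1}"

definition cube :: "nat \<Rightarrow> (nat \<Rightarrow> int) sgraph" where
  "cube n = cayley_graph (cube_group n) (cube_gens n)"


text \<open>The law of the \<open>k\<close>-th position of the walk from \<open>i\<close>, given the earlier positions \<open>\<omega>\<close>.
  The library leaves the distribution \<^term>\<open>pmf_of_set {}\<close> unspecified, so the walk is meaningful
  only on graphs without isolated vertices and with finite neighbourhoods.\<close>

definition srw_step :: "'a sgraph \<Rightarrow> 'a \<Rightarrow> nat \<Rightarrow> (nat \<Rightarrow> 'a) \<Rightarrow> 'a measure" where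
  "srw_step \<Gamma> i k \<omega> =
     measure_pmf (if k = 0 then return_pmf i else pmf_of_set (nbrs \<Gamma> (\<omega> (k - 1))))"

global_interpretation srw: Ionescu_Tulcea "srw_step \<Gamma> i" "\<lambda>_. count_space UNIV" for \<Gamma> i
proof (rule Ionescu_Tulcea.intro)
  fix k
  show "srw_step \<Gamma> i k
      \<in> measurable (PiM {0..<k} (\<lambda>_. count_space UNIV)) (subprob_algebra (count_space UNIV))"
  proof (cases k)
    case 0
    then show ?thesis
      by (simp add: srw_step_def[abs_def] measure_pmf_in_subprob_algebra)
  next
    case (Suc m)
    have "(\<lambda>\<omega>. \<omega> m) \<in> measurable (PiM {0..<k} (\<lambda>_. count_space UNIV)) (count_space UNIV)"
      using Suc by (intro measurable_component_singleton) auto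
    moreover have "(\<lambda>v. measure_pmf (pmf_of_set (nbrs \<Gamma> v)))
        \<in> measurable (count_space UNIV) (subprob_algebra (count_space UNIV))"
      by (simp add: measure_pmf_in_subprob_algebra)
    ultimately have "(\<lambda>\<omega>. measure_pmf (pmf_of_set (nbrs \<Gamma> (\<omega> m))))
        \<in> measurable (PiM {0..<k} (\<lambda>_. count_space UNIV)) (subprob_algebra (count_space UNIV))"
      by (rule measurable_compose)
    then show ?thesis
      using Suc by (simp add: srw_step_def[abs_def])
  qed
next
  fix k and \<omega> :: "nat \<Rightarrow> 'a"
  show "prob_space (srw_step \<Gamma> i k \<omega>)"
    by (simp add: srw_step_def measure_pmf.prob_space_axioms)
qed

text \<open>The law of the whole trajectory of the simple random walk from \<open>i\<close>, as the Markov process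
  with the transition kernels above (Ionescu-Tulcea).\<close>

definition srw :: "'a sgraph \<Rightarrow> 'a \<Rightarrow> (nat \<Rightarrow> 'a) measure" where
  "srw \<Gamma> i = srw.PF.lim \<Gamma> i"

text \<open>The first passage time is \<open>\<infinity>\<close> on trajectories that never visit \<open>j\<close>, since
  \<^term>\<open>Inf {} = (\<infinity> :: enat)\<close>.  Expectations are taken in \<^typ>\<open>ennreal\<close>, so
  no integrability is presupposed.\<close>

definition first_passage_time :: "'a \<Rightarrow> (nat \<Rightarrow> 'a) \<Rightarrow> enat" where
  "first_passage_time j \<omega> = Inf {enat k | k. \<omega> k = j}"

definition mean_first_passage_time :: "'a sgraph \<Rightarrow> 'a \<Rightarrow> 'a \<Rightarrow> ennreal" where
  "mean_first_passage_time \<Gamma> i j =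
     (\<integral>\<^sup>+\<omega>. ennreal_of_enat (first_passage_time j \<omega>) \<partial>srw \<Gamma> i)"

definition stationary :: "'a sgraph \<Rightarrow> 'a \<Rightarrow> real" where
  "stationary \<Gamma> j = real (vertex_degree \<Gamma> j) / (2 * real (card (edges \<Gamma>)))"

text \<open>The sum does not depend on the starting vertex \<open>i\<close> when the graph is finite and
  connected; the definite description is its common value over all \<open>i\<close>.\<close>

definition eigentime :: "'a sgraph \<Rightarrow> ennreal" where
  "eigentime \<Gamma> = (THE h. \<forall>i\<in>verts \<Gamma>.
     (\<Sum>j\<in>verts \<Gamma>. ennreal (stationary \<Gamma> j) * mean_first_passage_time \<Gamma> i j) = h)"

end

theory Submission
  imports Defs "HOL-Real_Asymp.Real_Asymp"
begin

text \<open>By the symmetry of the cube, the mean first-passage time from \<open>i\<close> to \<open>j\<close> depends only on the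
  Hamming distance \<open>d\<close> of \<open>i\<close> and \<open>j\<close>. The distance to \<open>j\<close> performs a birth-death chain, for which
  the mean time to get from \<open>m + 1\<close> to \<open>m\<close> is
  \<open>(\<Sum>l=m+1..n. n choose l) / ((n - 1) choose m)\<close>. The first term, \<open>m = 0\<close>, is \<open>2 ^ n - 1\<close>, while
  all the others together are \<open>o(2 ^ n)\<close>. So the passage time from any \<open>i \<noteq> j\<close> lies between
  \<open>2 ^ n - 1\<close> and \<open>2 ^ n * (1 + o(1))\<close>, and so does its average, up to the factor \<open>1 - 2 ^ (-n)\<close>
  that accounts for \<open>j = i\<close>.\<close>

section \<open>Mean first-passage times from first-step equations\<close>

lemma measurable_srw_eq:
  "measurable (srw \<Gamma> i) M = measurable (PiM UNIV (\<lambda>_. count_space UNIV)) M"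
  unfolding srw_def by (rule measurable_cong_sets) (simp_all only: srw.PF.sets_lim)

text \<open>\<open>srw.CI\<close> composes the kernels up to the least time beyond the index set and
  then projects; for an initial segment that time is \<open>n\<close> and nothing is projected
  away.\<close>

lemma CI_atLeastLessThan:
  "srw.CI \<Gamma> i {0..<n} = srw.C \<Gamma> i 0 n (\<lambda>_. undefined)"
proof -
  have "srw.up_to {0..<n} = n"
    using srw.up_to_iff[of "{0..<n}" n] srw.up_to_iff[of "{0..<n}" "srw.up_to {0..<n}"]
    by (metis atLeastLessThan_iff finite_atLeastLessThan le_antisym le_refl not_le zero_le)
  then show ?thesis
    using srw.distr_C[of n n "\<lambda>_. undefined" 0 \<Gamma> i] by (simp add: srw.CI_def space_PiM)
qed

text \<open>Passes from the limit measure on infinite trajectories to a composition of finitely many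
  kernels, where integrals can be computed.\<close>

lemma nn_integral_srw_restrict:
  assumes [measurable]: "f \<in> borel_measurable (PiM {0..<n} (\<lambda>_. count_space UNIV))"
  shows "(\<integral>\<^sup>+\<omega>. f (restrict \<omega> {0..<n}) \<partial>srw \<Gamma> i) = (\<integral>\<^sup>+\<omega>. f \<omega> \<partial>srw.C \<Gamma> i 0 n (\<lambda>_. undefined))"
proof -
  have "(\<integral>\<^sup>+\<omega>. f \<omega> \<partial>srw.C \<Gamma> i 0 n (\<lambda>_. undefined)) =
      (\<integral>\<^sup>+\<omega>. f \<omega> \<partial>distr (srw \<Gamma> i) (PiM {0..<n} (\<lambda>_. count_space UNIV)) (\<lambda>\<omega>. restrict \<omega> {0..<n}))"
    unfolding srw_def by (subst srw.distr_lim) (simp_all add: CI_atLeastLessThan)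
  also have "\<dots> = (\<integral>\<^sup>+\<omega>. f (restrict \<omega> {0..<n}) \<partial>srw \<Gamma> i)"
    by (rule nn_integral_distr) (auto simp: measurable_srw_eq intro!: measurable_restrict)
  finally show ?thesis ..
qed

lemma nn_integral_srw_0: "(\<integral>\<^sup>+\<omega>. f (\<omega> 0) \<partial>srw \<Gamma> i) = f i"
proof -
  have *: "(\<lambda>\<omega>. f (\<omega> 0)) \<in> borel_measurable (PiM {0..<Suc 0} (\<lambda>_. count_space UNIV))"
    by (rule measurable_compose[OF measurable_component_singleton]) auto
  have "(\<integral>\<^sup>+\<omega>. f (\<omega> 0) \<partial>srw \<Gamma> i) = (\<integral>\<^sup>+\<omega>. f (\<omega> 0) \<partial>srw.C \<Gamma> i 0 (Suc 0) (\<lambda>_. undefined))"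
    using nn_integral_srw_restrict[OF *] by simp
  also have "\<dots> = (\<integral>\<^sup>+\<omega>. f (\<omega> 0) \<partial>srw.eP \<Gamma> i 0 (\<lambda>_. undefined))"
  proof -
    have "(\<lambda>_. undefined) \<in> space (PiM {0..<0::nat} (\<lambda>_. count_space (UNIV :: 'a set)))"
      by (simp add: space_PiM)
    then show ?thesis
      using bind_return[OF srw.measurable_eP[of \<Gamma> i 0]] by (simp only: srw.C.simps add_0)
  qed
  also have "\<dots> = f i"
    by (subst srw.nn_integral_eP) (use * in \<open>simp_all add: space_PiM srw_step_def\<close>)
  finally show ?thesis .
qed

text \<open>Markov property: \<open>g\<close> sees only the positions up to time \<open>n\<close>,
  so integrating out the next position replaces \<open>f\<close> by its average over the neighbours
  of \<open>\<omega> n\<close>.\<close>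

lemma nn_integral_srw_Suc:
  assumes g[measurable]: "g \<in> borel_measurable (PiM {0..<Suc n} (\<lambda>_. count_space UNIV))"
  shows "(\<integral>\<^sup>+\<omega>. g (restrict \<omega> {0..<Suc n}) * f (\<omega> (Suc n)) \<partial>srw \<Gamma> i) =
    (\<integral>\<^sup>+\<omega>. g (restrict \<omega> {0..<Suc n}) * (\<integral>\<^sup>+w. f w \<partial>pmf_of_set (nbrs \<Gamma> (\<omega> n))) \<partial>srw \<Gamma> i)"
proof -
  let ?cs = "\<lambda>_::nat. count_space (UNIV :: 'a set)"
  let ?u = "\<lambda>_::nat. undefined :: 'a"
  let ?P = "\<lambda>v. \<integral>\<^sup>+w. f w \<partial>pmf_of_set (nbrs \<Gamma> v)"
  let ?h = "\<lambda>\<omega>. g (restrict \<omega> {0..<Suc n}) * f (\<omega> (Suc n))"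
  have u: "?u \<in> space (PiM {0..<0} ?cs)"
    by (simp add: space_PiM)
  have [measurable]: "(\<lambda>\<omega>. g (restrict \<omega> {0..<Suc n})) \<in> borel_measurable (PiM {0..<Suc (Suc n)} ?cs)"
    by (rule measurable_compose[OF measurable_restrict g]) auto
  have [measurable]: "(\<lambda>\<omega>. f (\<omega> (Suc n))) \<in> borel_measurable (PiM {0..<Suc (Suc n)} ?cs)"
    by (rule measurable_compose[OF measurable_component_singleton]) auto
  have P: "(\<lambda>\<omega>. ?P (\<omega> n)) \<in> borel_measurable (PiM {0..<Suc n} ?cs)"
    by (rule measurable_compose[OF measurable_component_singleton]) auto
  have h: "?h \<in> borel_measurable (PiM {0..<Suc (Suc n)} ?cs)"
    by measurable
  have "(\<integral>\<^sup>+\<omega>. ?h \<omega> \<partial>srw \<Gamma> i) = (\<integral>\<^sup>+\<omega>. ?h (restrict \<omega> {0..<Suc (Suc n)}) \<partial>srw \<Gamma> i)"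
    by (simp add: inf.absorb2)
  also have "\<dots> = (\<integral>\<^sup>+\<omega>. ?h \<omega> \<partial>srw.C \<Gamma> i 0 (Suc (Suc n)) ?u)"
    by (rule nn_integral_srw_restrict[OF h])
  also have "\<dots> = (\<integral>\<^sup>+\<omega>. (\<integral>\<^sup>+\<omega>'. ?h \<omega>' \<partial>srw.eP \<Gamma> i (Suc n) \<omega>) \<partial>srw.C \<Gamma> i 0 (Suc n) ?u)"
    unfolding srw.C.simps(2)[of _ _ _ "Suc n"] add_0
  proof (rule nn_integral_bind)
    have "sets (srw.C \<Gamma> i 0 (Suc n) ?u) = sets (PiM {0..<Suc n} ?cs)"
      by (simp only: srw.sets_C[OF u] add_0)
    then show "srw.eP \<Gamma> i (Suc n) \<in> measurable (srw.C \<Gamma> i 0 (Suc n) ?u)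
        (subprob_algebra (PiM {0..<Suc (Suc n)} ?cs))"
      by (rule measurable_cong_sets[OF _ refl, THEN equalityD2, THEN subsetD]) (rule srw.measurable_eP)
  qed (rule h)
  also have "\<dots> = (\<integral>\<^sup>+\<omega>. g \<omega> * ?P (\<omega> n) \<partial>srw.C \<Gamma> i 0 (Suc n) ?u)"
  proof (rule nn_integral_cong)
    fix \<omega> assume "\<omega> \<in> space (srw.C \<Gamma> i 0 (Suc n) ?u)"
    then have \<omega>: "\<omega> \<in> space (PiM {0..<Suc n} ?cs)"
      by (simp only: srw.space_C[OF u] add_0)
    then have *: "restrict (fun_upd \<omega> (Suc n) y) {0..<Suc n} = \<omega>" for y
      by (simp add: restrict_fupd space_PiM PiE_restrict)
    have "(\<integral>\<^sup>+\<omega>'. ?h \<omega>' \<partial>srw.eP \<Gamma> i (Suc n) \<omega>) =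
        (\<integral>\<^sup>+y. ?h (fun_upd \<omega> (Suc n) y) \<partial>srw_step \<Gamma> i (Suc n) \<omega>)"
      by (rule srw.nn_integral_eP[OF \<omega> h])
    also have "\<dots> = g \<omega> * ?P (\<omega> n)"
      by (simp only: *) (simp add: srw_step_def nn_integral_cmult)
    finally show "(\<integral>\<^sup>+\<omega>'. ?h \<omega>' \<partial>srw.eP \<Gamma> i (Suc n) \<omega>) = g \<omega> * ?P (\<omega> n)" .
  qed
  also have "\<dots> = (\<integral>\<^sup>+\<omega>. g (restrict \<omega> {0..<Suc n}) * ?P (restrict \<omega> {0..<Suc n} n) \<partial>srw \<Gamma> i)"
    by (rule nn_integral_srw_restrict[symmetric]) (intro borel_measurable_times_ennreal g P)
  finally show ?thesis
    by simp
qed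

text \<open>The weights needed below: \<open>S = V\<close> confines the walk to the graph, and
  \<open>S = V - {j}\<close> expresses that \<open>j\<close> has not been hit yet.\<close>

lemma nn_integral_srw_stay_Suc:
  fixes S :: "'a set" and f :: "'a \<Rightarrow> ennreal"
  shows "(\<integral>\<^sup>+\<omega>. indicator {\<omega>. \<forall>k\<le>n. \<omega> k \<in> S} \<omega> * f (\<omega> (Suc n)) \<partial>srw \<Gamma> i) =
    (\<integral>\<^sup>+\<omega>. indicator {\<omega>. \<forall>k\<le>n. \<omega> k \<in> S} \<omega> * (\<integral>\<^sup>+w. f w \<partial>pmf_of_set (nbrs \<Gamma> (\<omega> n))) \<partial>srw \<Gamma> i)"
proof -
  \<comment> \<open>As a product of indicators of single coordinates, the event is visibly
    measurable and depends on the first \<open>n + 1\<close> positions only.\<close>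
  let ?g = "\<lambda>\<omega> :: nat \<Rightarrow> 'a. \<Prod>k\<le>n. indicator S (\<omega> k) :: ennreal"
  have ind: "indicator {\<omega>. \<forall>k\<le>n. \<omega> k \<in> S} \<omega> = ?g (restrict \<omega> {0..<Suc n})" for \<omega>
    by (auto simp: indicator_def)
  have "?g \<in> borel_measurable (PiM {0..<Suc n} (\<lambda>_. count_space UNIV))"
    by (intro borel_measurable_prod_ennreal measurable_compose[OF measurable_component_singleton]) auto
  then show ?thesis
    unfolding ind by (rule nn_integral_srw_Suc)
qed

lemma sets_srw_stay:
  fixes S :: "'a set"
  shows "{\<omega>. \<forall>k\<le>n. \<omega> k \<in> S} \<in> sets (srw \<Gamma> i)"
proof -
  let ?P = "PiM UNIV (\<lambda>_::nat. count_space (UNIV :: 'a set))"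
  have "{\<omega> \<in> space ?P. \<forall>k\<in>{..n}. \<omega> k \<in> S} \<in> sets ?P"
  proof (rule sets.sets_Collect_finite_All[OF _ finite_atMost])
    fix k
    have "(\<lambda>\<omega>. \<omega> k) -` S \<inter> space ?P \<in> sets ?P"
      by (rule measurable_sets[OF measurable_component_singleton]) auto
    then show "{\<omega> \<in> space ?P. \<omega> k \<in> S} \<in> sets ?P"
      by (simp only: vimage_def Int_def mem_Collect_eq conj_commute)
  qed
  then show ?thesis
    by (simp add: srw_def space_PiM Ball_def)
qed

text \<open>Each step from \<open>V\<close> is uniform on a nonempty finite subset of
  \<open>V\<close>, so by induction no mass leaves \<open>V\<close>. Outside \<open>V\<close>
  nothing is known about the steps.\<close>

lemma emeasure_srw_nbrs_closed:
  assumes "i \<in> V" and "\<And>v. v \<in> V \<Longrightarrow> finite (nbrs \<Gamma> v) \<and> nbrs \<Gamma> v \<noteq> {} \<and> nbrs \<Gamma> v \<subseteq> V"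
  shows "emeasure (srw \<Gamma> i) {\<omega>. \<forall>k\<le>n. \<omega> k \<in> V} = 1"
proof (induction n)
  case 0
  show ?case
    using assms(1) nn_integral_srw_0[of \<Gamma> i "indicator V"] sets_srw_stay[of 0 V \<Gamma> i]
    by (simp flip: nn_integral_indicator add: indicator_def)
next
  case (Suc n)
  have "emeasure (srw \<Gamma> i) {\<omega>. \<forall>k\<le>Suc n. \<omega> k \<in> V} =
      (\<integral>\<^sup>+\<omega>. indicator {\<omega>. \<forall>k\<le>n. \<omega> k \<in> V} \<omega> * indicator V (\<omega> (Suc n)) \<partial>srw \<Gamma> i)"
    unfolding nn_integral_indicator[OF sets_srw_stay, symmetric]
    by (rule nn_integral_cong) (auto simp: indicator_def le_Suc_eq)
  also have "\<dots> = (\<integral>\<^sup>+\<omega>. indicator {\<omega>. \<forall>k\<le>n. \<omega> k \<in> V} \<omega> \<partial>srw \<Gamma> i)"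
    unfolding nn_integral_srw_stay_Suc
  proof (rule nn_integral_cong)
    fix \<omega> :: "nat \<Rightarrow> 'a"
    have "(\<integral>\<^sup>+w. indicator V w \<partial>pmf_of_set (nbrs \<Gamma> (\<omega> n))) = 1" if "\<omega> n \<in> V"
      using assms(2)[OF that] by (simp add: emeasure_pmf_of_set inf.absorb1 ennreal_divide_self card_gt_0_iff)
    then show "indicator {\<omega>. \<forall>k\<le>n. \<omega> k \<in> V} \<omega> *
        (\<integral>\<^sup>+ w. indicator V w \<partial>pmf_of_set (nbrs \<Gamma> (\<omega> n))) = indicator {\<omega>. \<forall>k\<le>n. \<omega> k \<in> V} \<omega>"
      by (cases "\<forall>k\<le>n. \<omega> k \<in> V") (simp_all del: nn_integral_indicator)
  qed
  finally show ?case
    using Suc by (simp add: sets_srw_stay)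
qed

section \<open>First-passage times and their expectations\<close>

lemma less_first_passage_time_iff:
  "enat n < first_passage_time j \<omega> \<longleftrightarrow> (\<forall>k\<le>n. \<omega> k \<noteq> j)"
proof -
  have "first_passage_time j \<omega> \<le> enat n \<longleftrightarrow> (\<exists>k\<le>n. \<omega> k = j)"
  proof
    assume *: "first_passage_time j \<omega> \<le> enat n"
    \<comment> \<open>The empty set has infimum infinity, so the set of visit times is nonempty; its
      infimum is then attained, since \<open>enat\<close> is well-ordered.\<close>
    have "\<exists>x. x \<in> {enat k | k. \<omega> k = j}"
    proof (rule ccontr)
      assume "\<nexists>x. x \<in> {enat k | k. \<omega> k = j}"
      then have "{enat k | k. \<omega> k = j} = {}"
        by blast
      then have "first_passage_time j \<omega> = \<infinity>"
        by (simp only: first_passage_time_def Inf_enat_def simp_thms if_True)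
      with * show False
        by simp
    qed
    then obtain x where "x \<in> {enat k | k. \<omega> k = j}"
      by (rule exE)
    then have "first_passage_time j \<omega> \<in> {enat k | k. \<omega> k = j}"
      unfolding first_passage_time_def by (rule wellorder_InfI)
    then obtain k where "first_passage_time j \<omega> = enat k" "\<omega> k = j"
      by blast
    with * show "\<exists>k\<le>n. \<omega> k = j"
      by (metis enat_ord_simps(1))
  next
    assume "\<exists>k\<le>n. \<omega> k = j"
    then obtain k where k: "k \<le> n" "\<omega> k = j"
      by blast
    then have "first_passage_time j \<omega> \<le> enat k"
      unfolding first_passage_time_def by (intro Inf_lower) blast
    with k(1) show "first_passage_time j \<omega> \<le> enat n"
      by (meson enat_ord_simps(1) order_trans)
  qed
  then show ?thesis
    by (metis not_le)
qed

text \<open>The passage time is a countable infimum of functions of single coordinates, each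
  carrying the discrete sigma-algebra.\<close>

lemma measurable_first_passage_time:
  "first_passage_time j \<in> measurable (srw \<Gamma> i) (count_space UNIV)"
proof -
  have "first_passage_time j = (\<lambda>\<omega>. INF k. if \<omega> k = j then enat k else \<infinity>)"
    unfolding first_passage_time_def
    by (intro ext antisym INF_greatest Inf_greatest)
      (auto intro!: Inf_lower INF_lower2 simp: image_iff)
  moreover have "(\<lambda>\<omega>. INF k. if \<omega> k = j then enat k else \<infinity>) \<in>
      measurable (PiM UNIV (\<lambda>_. count_space UNIV)) (count_space UNIV)"
    by measurable
  ultimately show ?thesis
    by (simp add: measurable_srw_eq)
qed

text \<open>Tail-sum formula for the expectation of an \<open>enat\<close>-valued variable.\<close>

lemma mean_first_passage_time_eq_suminf:
  "mean_first_passage_time \<Gamma> i j = suminf (\<lambda>n. emeasure (srw \<Gamma> i) {\<omega>. \<forall>k\<le>n. \<omega> k \<noteq> j})"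
proof -
  have "space (srw \<Gamma> i) = UNIV"
    by (simp add: srw_def space_PiM)
  then show ?thesis
    unfolding mean_first_passage_time_def nn_integral_enat_function[OF measurable_first_passage_time]
    by (simp add: less_first_passage_time_iff)
qed

text \<open>If \<open>h\<close> solves the first-step equations, then the expectation \<open>a n\<close> of \<open>h\<close> at time \<open>n\<close> on
  the event that \<open>j\<close> has not been visited by then drops by exactly the probability of that event,
  so these probabilities sum to \<open>h i\<close>; boundedness of \<open>h\<close> forces \<open>a n\<close> to vanish in the limit.\<close>

lemma mean_first_passage_time_eqI:
  fixes h :: "'a \<Rightarrow> ennreal"
  assumes nbrs: "\<And>v. v \<in> V \<Longrightarrow> finite (nbrs \<Gamma> v) \<and> nbrs \<Gamma> v \<noteq> {} \<and> nbrs \<Gamma> v \<subseteq> V"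
    and step: "\<And>v. v \<in> V \<Longrightarrow> v \<noteq> j \<Longrightarrow>
      h v = 1 + (\<Sum>w\<in>nbrs \<Gamma> v. h w) / of_nat (card (nbrs \<Gamma> v))"
    and h: "h j = 0" "\<And>v. v \<in> V \<Longrightarrow> h v \<le> M" "M < \<top>"
    and i: "i \<in> V"
  shows "mean_first_passage_time \<Gamma> i j = h i"
proof -
  define B where "B n = {\<omega> :: nat \<Rightarrow> 'a. \<forall>k\<le>n. \<omega> k \<in> V - {j}}" for n
  define p where "p n = emeasure (srw \<Gamma> i) (B n)" for n
  define a where "a n = (\<integral>\<^sup>+\<omega>. indicator (B n) \<omega> * h (\<omega> n) \<partial>srw \<Gamma> i)" for n
  have B[measurable]: "B n \<in> sets (srw \<Gamma> i)" for n
    unfolding B_def by (rule sets_srw_stay)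
  have meas: "(\<lambda>\<omega>. f (\<omega> n)) \<in> borel_measurable (srw \<Gamma> i)" for f :: "'a \<Rightarrow> ennreal" and n
    unfolding measurable_srw_eq
    by (rule measurable_compose[OF measurable_component_singleton]) auto
  note meas[measurable]
  \<comment> \<open>Almost surely the walk stays in \<open>V\<close>, so avoiding \<open>j\<close>
    has the same probability as staying in \<open>V - {j}\<close>.\<close>
  have prob: "emeasure (srw \<Gamma> i) {\<omega>. \<forall>k\<le>n. \<omega> k \<noteq> j} = p n" for n
  proof -
    let ?A = "{\<omega>. \<forall>k\<le>n. \<omega> k \<in> - {j}}" and ?W = "{\<omega>. \<forall>k\<le>n. \<omega> k \<in> V}"
    have sp: "space (srw \<Gamma> i) = UNIV"
      by (simp add: srw_def space_PiM)
    have "emeasure (srw \<Gamma> i) UNIV = 1"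
      using nn_integral_srw_0[of \<Gamma> i "\<lambda>_. 1"] by (simp add: sp)
    then interpret prob_space "srw \<Gamma> i"
      by (intro prob_spaceI) (simp add: sp)
    have W: "AE \<omega> in srw \<Gamma> i. \<omega> \<in> ?W"
      using emeasure_srw_nbrs_closed[OF i nbrs, of n] sets_srw_stay[of n V \<Gamma> i]
      by (intro AE_in_set_eq_1[THEN iffD2]) (simp_all add: emeasure_eq_measure)
    have "emeasure (srw \<Gamma> i) ?A = emeasure (srw \<Gamma> i) (B n)"
    proof (rule emeasure_eq_AE[OF _ sets_srw_stay B])
      show "AE \<omega> in srw \<Gamma> i. \<omega> \<in> ?A \<longleftrightarrow> \<omega> \<in> B n"
        using W by eventually_elim (auto simp: B_def)
    qed
    then show ?thesis
      by (simp add: p_def)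
  qed
  have a_0: "a 0 = h i"
    using i h(1) nn_integral_srw_0[of \<Gamma> i "\<lambda>v. indicator (V - {j}) v * h v"]
    by (auto simp: a_def B_def indicator_def)
  have a_Suc: "a n = p n + a (Suc n)" for n
  proof -
    \<comment> \<open>The factor \<open>indicator V w\<close> does not change the average, as
      neighbours lie in \<open>V\<close>; together with \<open>h j = 0\<close> it later turns
      \<open>B n\<close> into \<open>B (Suc n)\<close>.\<close>
    have "a n = (\<integral>\<^sup>+\<omega>. indicator (B n) \<omega> + indicator (B n) \<omega> *
        (\<integral>\<^sup>+w. indicator V w * h w \<partial>pmf_of_set (nbrs \<Gamma> (\<omega> n))) \<partial>srw \<Gamma> i)"
      unfolding a_def
    proof (rule nn_integral_cong)
      fix \<omega> :: "nat \<Rightarrow> 'a"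
      show "indicator (B n) \<omega> * h (\<omega> n) = indicator (B n) \<omega> + indicator (B n) \<omega> *
          (\<integral>\<^sup>+w. indicator V w * h w \<partial>pmf_of_set (nbrs \<Gamma> (\<omega> n)))"
      proof (cases "\<omega> \<in> B n")
        case True
        then have v: "\<omega> n \<in> V" "\<omega> n \<noteq> j"
          by (auto simp: B_def)
        have "(\<Sum>w\<in>nbrs \<Gamma> (\<omega> n). indicator V w * h w) = (\<Sum>w\<in>nbrs \<Gamma> (\<omega> n). h w)"
          using nbrs[OF v(1)] by (intro sum.cong) auto
        then show ?thesis
          using True nbrs[OF v(1)] step[OF v] by (simp add: nn_integral_pmf_of_set)
      qed simp
    qed
    also have "\<dots> = p n + (\<integral>\<^sup>+\<omega>. indicator (B n) \<omega> *
        (\<integral>\<^sup>+w. indicator V w * h w \<partial>pmf_of_set (nbrs \<Gamma> (\<omega> n))) \<partial>srw \<Gamma> i)"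
      unfolding p_def
      by (subst nn_integral_add) (auto intro!: borel_measurable_times_ennreal meas)
    also have "(\<integral>\<^sup>+\<omega>. indicator (B n) \<omega> *
        (\<integral>\<^sup>+w. indicator V w * h w \<partial>pmf_of_set (nbrs \<Gamma> (\<omega> n))) \<partial>srw \<Gamma> i) =
        (\<integral>\<^sup>+\<omega>. indicator (B n) \<omega> * (indicator V (\<omega> (Suc n)) * h (\<omega> (Suc n))) \<partial>srw \<Gamma> i)"
      unfolding B_def by (rule nn_integral_srw_stay_Suc[symmetric])
    also have "\<dots> = a (Suc n)"
      unfolding a_def
    proof (rule nn_integral_cong)
      fix \<omega> :: "nat \<Rightarrow> 'a"
      have "\<omega> \<in> B (Suc n) \<longleftrightarrow> \<omega> \<in> B n \<and> \<omega> (Suc n) \<in> V \<and> \<omega> (Suc n) \<noteq> j"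
        by (auto simp: B_def le_Suc_eq)
      moreover have "\<omega> (Suc n) = j \<Longrightarrow> h (\<omega> (Suc n)) = 0"
        by (simp only: h(1))
      ultimately show "indicator (B n) \<omega> * (indicator V (\<omega> (Suc n)) * h (\<omega> (Suc n))) =
          indicator (B (Suc n)) \<omega> * h (\<omega> (Suc n))"
        by (cases "\<omega> (Suc n) = j") (simp_all split: split_indicator)
    qed
    finally show ?thesis .
  qed
  have sum_p: "(\<Sum>k<n. p k) + a n = h i" for n
  proof (induction n)
    case (Suc n)
    then show ?case
      by (simp add: a_Suc[of n] add.assoc)
  qed (simp add: a_0)
  have fin: "h i < \<top>"
    using h(2)[OF i] h(3) by (rule le_less_trans)
  have sums: "(\<lambda>n. \<Sum>k<n. p k) \<longlonglongrightarrow> suminf p"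
    by (rule summable_LIMSEQ) simp
  have "suminf p \<le> h i"
    by (rule LIMSEQ_le_const2[OF sums]) (metis sum_p le_iff_add)
  with fin have "suminf p < \<top>"
    by (metis le_less_trans)
  \<comment> \<open>The terms are differences of consecutive partial sums; finiteness of the sum
    makes the subtraction in \<open>ennreal\<close> legitimate.\<close>
  have "p \<longlonglongrightarrow> suminf p - suminf p"
  proof -
    have "(\<lambda>n. (\<Sum>k<Suc n. p k) - (\<Sum>k<n. p k)) \<longlonglongrightarrow> suminf p - suminf p"
      using sums \<open>suminf p < \<top>\<close>
      by (intro tendsto_diff_ennreal LIMSEQ_Suc) auto
    moreover have "(\<Sum>k<n. p k) \<noteq> \<top>" for n
      by (metis sum_p fin ennreal_add_eq_top less_irrefl)
    ultimately show ?thesis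
      by (simp add: ennreal_add_diff_cancel_left)
  qed
  then have "p \<longlonglongrightarrow> 0"
    using \<open>suminf p < \<top>\<close> by simp
  then have "(\<lambda>n. M * p n) \<longlonglongrightarrow> M * 0"
    using h(3) by (intro ennreal_tendsto_cmult) auto
  moreover have "a n \<le> M * p n" for n
  proof -
    have "a n \<le> (\<integral>\<^sup>+\<omega>. M * indicator (B n) \<omega> \<partial>srw \<Gamma> i)"
      unfolding a_def by (rule nn_integral_mono) (auto simp: B_def indicator_def h(2))
    also have "\<dots> = M * p n"
      unfolding p_def by (simp add: nn_integral_cmult)
    finally show ?thesis .
  qed
  ultimately have "a \<longlonglongrightarrow> 0"
    by (intro tendsto_sandwich[of "\<lambda>_. 0" a sequentially "\<lambda>n. M * p n"]) auto
  with sums have "(\<lambda>n. (\<Sum>k<n. p k) + a n) \<longlonglongrightarrow> suminf p + 0"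
    by (intro tendsto_add)
  then have "suminf p = h i"
    by (simp add: sum_p LIMSEQ_const_iff)
  then show ?thesis
    by (simp add: mean_first_passage_time_eq_suminf prob)
qed

section \<open>Geometry of the cube\<close>

text \<open>Handshake lemma, by double counting incidences: edges have two distinct ends, and
  \<open>w\<close> corresponds to the edge \<open>{v, w}\<close> at \<open>v\<close>.\<close>

lemma sum_vertex_degree:
  assumes fin: "finite (verts \<Gamma>)"
    and edges: "\<And>e. e \<in> edges \<Gamma> \<Longrightarrow> \<exists>v w. v \<in> verts \<Gamma> \<and> w \<in> verts \<Gamma> \<and> v \<noteq> w \<and> e = {v, w}"
  shows "(\<Sum>v\<in>verts \<Gamma>. vertex_degree \<Gamma> v) = 2 * card (edges \<Gamma>)"
proof -
  have finE: "finite (edges \<Gamma>)"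
    by (rule finite_subset[of _ "Pow (verts \<Gamma>)"]) (use edges fin in fastforce)+
  have "(\<Sum>v\<in>verts \<Gamma>. card {e \<in> edges \<Gamma>. v \<in> e}) = 2 * card (edges \<Gamma>)"
  proof (rule sum_multicount[OF fin finE], rule ballI)
    fix e assume "e \<in> edges \<Gamma>"
    then obtain v w where "v \<in> verts \<Gamma>" "w \<in> verts \<Gamma>" "v \<noteq> w" "e = {v, w}"
      using edges by blast
    then have "{v \<in> verts \<Gamma>. v \<in> e} = {v, w}"
      by auto
    with \<open>v \<noteq> w\<close> show "card {v \<in> verts \<Gamma>. v \<in> e} = 2"
      by simp
  qed
  moreover have "vertex_degree \<Gamma> v = card {e \<in> edges \<Gamma>. v \<in> e}" if "v \<in> verts \<Gamma>" for v
  proof -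
    have "{e \<in> edges \<Gamma>. v \<in> e} = (\<lambda>w. {v, w}) ` nbrs \<Gamma> v"
    proof (intro equalityI subsetI)
      fix e assume e: "e \<in> {e \<in> edges \<Gamma>. v \<in> e}"
      then obtain x y where "x \<in> verts \<Gamma>" "y \<in> verts \<Gamma>" "e = {x, y}"
        using edges by blast
      with e obtain w where "w \<in> verts \<Gamma>" "e = {v, w}"
        by auto
      with e show "e \<in> (\<lambda>w. {v, w}) ` nbrs \<Gamma> v"
        by (auto simp: nbrs_def)
    qed (auto simp: nbrs_def)
    moreover have "inj_on (\<lambda>w. {v, w}) (nbrs \<Gamma> v)"
      by (auto simp: inj_on_def doubleton_eq_iff)
    ultimately show ?thesis
      by (simp add: vertex_degree_def card_image)
  qed
  ultimately show ?thesis
    by simp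
qed

section \<open>The cube in terms of coordinate flips\<close>

lemma verts_cube: "verts (cube n) = {1..n} \<rightarrow>\<^sub>E {0, 1}"
proof -
  have "{0..<2} = {0, 1 :: int}"
    by auto
  then show ?thesis
    by (simp add: cube_def cayley_graph_def cube_group_def carrier_integer_mod_group)
qed

lemma card_verts_cube: "card (verts (cube n)) = 2 ^ n"
  by (simp add: verts_cube card_PiE numeral_2_eq_2)

lemma finite_verts_cube: "finite (verts (cube n))"
  by (simp add: verts_cube finite_PiE)

text \<open>Addition of the \<open>l\<close>-th generator modulo 2; the form \<open>1 - v l\<close>
  makes it a fixed-point-free involution on all integer-valued functions.\<close>

definition flip :: "nat \<Rightarrow> (nat \<Rightarrow> int) \<Rightarrow> nat \<Rightarrow> int" where
  "flip l v = v(l := 1 - v l)"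

lemma flip_flip: "flip l (flip l v) = v"
  by (simp add: flip_def)

lemma flip_in_verts_cube: "v \<in> verts (cube n) \<Longrightarrow> l \<in> {1..n} \<Longrightarrow> flip l v \<in> verts (cube n)"
  by (auto simp: verts_cube flip_def PiE_iff extensional_def)

lemma flip_neq: "flip l v \<noteq> v"
proof
  assume "flip l v = v"
  then have "1 - v l = v l"
    by (metis flip_def fun_upd_same)
  then show False
    by presburger
qed

lemma inj_flip: "inj (\<lambda>l. flip l v)"
proof (rule injI)
  fix k l assume "flip k v = flip l v"
  show "k = l"
  proof (rule ccontr)
    assume "k \<noteq> l"
    with fun_cong[OF \<open>flip k v = flip l v\<close>, of k] have "1 - v k = v k"
      by (simp add: flip_def)
    then show False
      by presburger
  qed
qed

lemma cube_gens_eq: "cube_gens n = (\<lambda>l. \<lambda>i\<in>{1..n}. if i = l then 1 else 0) ` {1..n}"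
proof (intro equalityI subsetI)
  fix x assume x: "x \<in> cube_gens n"
  then have car: "x \<in> {1..n} \<rightarrow>\<^sub>E {0, 1}"
    using verts_cube[of n] by (simp add: cube_gens_def cube_def cayley_graph_def)
  from x obtain l where l: "l \<in> {1..n}" "x l = 1" "\<And>i. i \<in> {1..n} \<Longrightarrow> x i = 1 \<Longrightarrow> i = l"
    by (auto simp: cube_gens_def)
  have "x = (\<lambda>i\<in>{1..n}. if i = l then 1 else 0)"
  proof
    fix i
    show "x i = (\<lambda>i\<in>{1..n}. if i = l then 1 else 0) i"
    proof (cases "i \<in> {1..n}")
      case True
      then have "x i = 0 \<or> x i = 1"
        using car by (auto simp: PiE_iff)
      then have "x i = (if i = l then 1 else 0)"
        using l(2) l(3)[OF True] by presburger
      with True show ?thesis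
        by (simp only: restrict_apply if_True)
    next
      case False
      with car have "x i = undefined"
        by (rule PiE_arb)
      with False show ?thesis
        by (simp only: restrict_apply if_False)
    qed
  qed
  with l(1) show "x \<in> (\<lambda>l. \<lambda>i\<in>{1..n}. if i = l then 1 else 0) ` {1..n}"
    by blast
next
  fix x assume "x \<in> (\<lambda>l. \<lambda>i\<in>{1..n}. if i = l then 1 else (0::int)) ` {1..n}"
  then obtain l where "l \<in> {1..n}" "x = (\<lambda>i\<in>{1..n}. if i = l then 1 else 0)"
    by blast
  then show "x \<in> cube_gens n"
    by (auto simp: cube_gens_def cube_group_def carrier_integer_mod_group)
qed

lemma cube_mult_gen:
  assumes "v \<in> verts (cube n)" "l \<in> {1..n}"
  shows "v \<otimes>\<^bsub>cube_group n\<^esub> (\<lambda>i\<in>{1..n}. if i = l then 1 else 0) = flip l v"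
proof
  fix i
  have "i \<in> {1..n} \<Longrightarrow> v i = 0 \<or> v i = 1" "i \<notin> {1..n} \<Longrightarrow> v i = undefined"
    using assms(1) by (auto simp: verts_cube PiE_iff extensional_def)
  then show "(v \<otimes>\<^bsub>cube_group n\<^esub> (\<lambda>i\<in>{1..n}. if i = l then 1 else 0)) i = flip l v i"
    using assms(2) by (auto simp: cube_group_def flip_def)
qed

lemma edges_cube: "edges (cube n) = {{v, flip l v} | v l. v \<in> verts (cube n) \<and> l \<in> {1..n}}"
proof -
  let ?gen = "\<lambda>l. \<lambda>i\<in>{1..n}. if i = l then 1 else (0::int)"
  have "edges (cube n) =
      (\<Union>v\<in>verts (cube n). (\<lambda>s. {v, v \<otimes>\<^bsub>cube_group n\<^esub> s}) ` cube_gens n)"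
    unfolding cube_def cayley_graph_def by auto
  also have "\<dots> = (\<Union>v\<in>verts (cube n). (\<lambda>l. {v, v \<otimes>\<^bsub>cube_group n\<^esub> ?gen l}) ` {1..n})"
    by (simp only: cube_gens_eq image_image)
  also have "\<dots> = (\<Union>v\<in>verts (cube n). (\<lambda>l. {v, flip l v}) ` {1..n})"
    by (intro SUP_cong image_cong refl) (simp only: cube_mult_gen)
  finally show ?thesis
    by blast
qed

lemma nbrs_cube:
  assumes "v \<in> verts (cube n)"
  shows "nbrs (cube n) v = (\<lambda>l. flip l v) ` {1..n}"
proof (intro equalityI subsetI)
  fix w assume "w \<in> nbrs (cube n) v"
  then obtain u l where "{v, w} = {u, flip l u}" and l: "l \<in> {1..n}"
    by (auto simp: nbrs_def edges_cube)
  \<comment> \<open>Either end of the edge may be \<open>v\<close>; since \<open>flip l\<close> is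
    an involution, the other end is \<open>flip l v\<close> in both cases.\<close>
  then have "w = flip l v"
    by (auto simp: doubleton_eq_iff flip_flip)
  with l show "w \<in> (\<lambda>l. flip l v) ` {1..n}"
    by blast
next
  fix w assume "w \<in> (\<lambda>l. flip l v) ` {1..n}"
  then obtain l where l: "l \<in> {1..n}" "w = flip l v"
    by blast
  then have "{v, w} \<in> edges (cube n)"
    using assms unfolding edges_cube by blast
  then show "w \<in> nbrs (cube n) v"
    using l flip_in_verts_cube[OF assms] by (simp add: nbrs_def)
qed

lemma card_nbrs_cube: "v \<in> verts (cube n) \<Longrightarrow> card (nbrs (cube n) v) = n"
  by (simp add: nbrs_cube card_image inj_on_subset[OF inj_flip])

text \<open>The cube is \<open>n\<close>-regular, so the handshake lemma gives
  \<open>2 ^ n * n\<close> for twice the number of edges, and the positive \<open>n\<close>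
  cancels.\<close>

lemma stationary_cube:
  assumes "0 < n" "v \<in> verts (cube n)"
  shows "stationary (cube n) v = 1 / 2 ^ n"
proof -
  have "(\<Sum>v\<in>verts (cube n). vertex_degree (cube n) v) = 2 * card (edges (cube n))"
  proof (rule sum_vertex_degree[OF finite_verts_cube])
    fix e assume "e \<in> edges (cube n)"
    then obtain v l where "v \<in> verts (cube n)" "l \<in> {1..n}" "e = {v, flip l v}"
      by (auto simp: edges_cube)
    then show "\<exists>v w. v \<in> verts (cube n) \<and> w \<in> verts (cube n) \<and> v \<noteq> w \<and> e = {v, w}"
      using flip_in_verts_cube flip_neq by metis
  qed
  then have "2 * card (edges (cube n)) = 2 ^ n * n"
    by (simp add: vertex_degree_def card_nbrs_cube card_verts_cube)
  then have "2 * real (card (edges (cube n))) = 2 ^ n * real n"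
    by (metis of_nat_mult of_nat_numeral of_nat_power)
  then show ?thesis
    using assms by (simp add: stationary_def vertex_degree_def card_nbrs_cube)
qed

text \<open>A set rather than the Hamming distance itself: a flip toggles one element, and for fixed
  \<open>v\<close> these sets enumerate the vertices.\<close>

definition diff_coords :: "nat \<Rightarrow> (nat \<Rightarrow> int) \<Rightarrow> (nat \<Rightarrow> int) \<Rightarrow> nat set" where
  "diff_coords n v w = {l \<in> {1..n}. v l \<noteq> w l}"

lemma finite_diff_coords: "finite (diff_coords n v w)"
  by (simp add: diff_coords_def)

lemma card_diff_coords_le: "card (diff_coords n v w) \<le> n"
proof -
  have "card (diff_coords n v w) \<le> card {1..n}"
    by (rule card_mono) (auto simp: diff_coords_def)
  then show ?thesis
    by simp
qed

lemma diff_coords_flip: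
  assumes "v \<in> verts (cube n)" "w \<in> verts (cube n)" "l \<in> {1..n}"
  shows "diff_coords n (flip l v) w =
    (if l \<in> diff_coords n v w then diff_coords n v w - {l} else insert l (diff_coords n v w))"
proof -
  have "v l \<in> {0, 1}" "w l \<in> {0, 1}"
    using assms by (auto simp: verts_cube PiE_iff)
  then show ?thesis
    using assms(3) by (cases "v l = w l") (auto simp: diff_coords_def flip_def)
qed

lemma diff_coords_eq_empty_iff:
  assumes "v \<in> verts (cube n)" "w \<in> verts (cube n)"
  shows "diff_coords n v w = {} \<longleftrightarrow> v = w"
proof
  assume "diff_coords n v w = {}"
  then have "v l = w l" if "l \<in> {1..n}" for l
    using that by (auto simp: diff_coords_def)
  with assms show "v = w"
    unfolding verts_cube by (rule PiE_ext)
qed (simp add: diff_coords_def)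

text \<open>Bits have two values, so \<open>v\<close> and the differing coordinates determine
  \<open>w\<close>; surjectivity follows since both sides have \<open>2 ^ n\<close>
  elements.\<close>

lemma bij_betw_diff_coords:
  assumes v: "v \<in> verts (cube n)"
  shows "bij_betw (diff_coords n v) (verts (cube n)) (Pow {1..n})"
proof -
  have inj: "inj_on (diff_coords n v) (verts (cube n))"
  proof (rule inj_onI)
    fix w w' assume w: "w \<in> verts (cube n)" "w' \<in> verts (cube n)"
      and eq: "diff_coords n v w = diff_coords n v w'"
    show "w = w'"
    proof (rule PiE_ext)
      show "w \<in> {1..n} \<rightarrow>\<^sub>E {0, 1}" "w' \<in> {1..n} \<rightarrow>\<^sub>E {0, 1}"
        using w by (simp_all add: verts_cube)
      fix l assume l: "l \<in> {1..n}"
      then have "v l \<in> {0, 1}" "w l \<in> {0, 1}" "w' l \<in> {0, 1}"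
        using v w by (auto simp: verts_cube PiE_iff)
      moreover have "v l \<noteq> w l \<longleftrightarrow> v l \<noteq> w' l"
        using eq l by (auto simp: diff_coords_def set_eq_iff)
      ultimately show "w l = w' l"
        by auto
    qed
  qed
  have "diff_coords n v ` verts (cube n) = Pow {1..n}"
  proof (rule card_subset_eq)
    show "card (diff_coords n v ` verts (cube n)) = card (Pow {1..n})"
      by (simp add: card_image[OF inj] card_verts_cube card_Pow)
  qed (auto simp: diff_coords_def)
  with inj show ?thesis
    by (simp add: bij_betw_def)
qed

section \<open>Hitting times on the cube\<close>

text \<open>The mean time of the \<open>n\<close>-cube walk from Hamming distance \<open>m + 1\<close> to \<open>m\<close> is the stationary
  mass of the distances above \<open>m\<close>, divided by the stationary flow
  \<open>(n choose (m + 1)) * (m + 1) / n = (n - 1) choose m\<close> (before normalization) from \<open>m + 1\<close>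
  to \<open>m\<close>.\<close>

definition descent_time :: "nat \<Rightarrow> nat \<Rightarrow> real" where
  "descent_time n m = (\<Sum>l=Suc m..n. real (n choose l)) / real ((n - 1) choose m)"

definition hitting_time :: "nat \<Rightarrow> nat \<Rightarrow> real" where
  "hitting_time n d = (\<Sum>m<d. descent_time n m)"

lemma descent_time_nonneg: "0 \<le> descent_time n m"
  by (simp add: descent_time_def sum_nonneg)

lemma hitting_time_nonneg: "0 \<le> hitting_time n d"
  by (simp add: hitting_time_def sum_nonneg descent_time_nonneg)

lemma hitting_time_mono: "d \<le> d' \<Longrightarrow> hitting_time n d \<le> hitting_time n d'"
  unfolding hitting_time_def by (rule sum_mono2) (auto simp: descent_time_nonneg)

lemma hitting_time_Suc: "hitting_time n (Suc d) = hitting_time n d + descent_time n d"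
  by (simp add: hitting_time_def)

text \<open>Peeling the first binomial off the tail sum yields the term \<open>n\<close> by
  absorption; a second absorption identity changes the denominator of the remaining sum to that of
  \<open>descent_time n (Suc m)\<close>.\<close>

lemma descent_time_rec:
  assumes "m < n"
  shows "real (Suc m) * descent_time n m = real n + real (n - Suc m) * descent_time n (Suc m)"
proof -
  obtain N where N: "n = Suc N"
    using assms by (cases n) auto
  define S where "S k = (\<Sum>l=Suc k..n. real (n choose l))" for k
  have dt: "descent_time n k = S k / real (N choose k)" for k
    by (simp only: descent_time_def S_def N diff_Suc_1)
  have pos: "0 < real (N choose m)"
    using assms N by simp
  have S: "S m = real (n choose Suc m) + S (Suc m)"
    unfolding S_def using assms by (intro sum.atLeast_Suc_atMost) simp
  have absorb: "real (Suc m) * real (n choose Suc m) = real n * real (N choose m)"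
    unfolding N by (metis Suc_times_binomial of_nat_mult)
  have "real (Suc m) * (S (Suc m) / real (N choose m)) = real (n - Suc m) * descent_time n (Suc m)"
  proof (cases "m < N")
    case True
    have "Suc m * (N choose Suc m) = (N - m) * (N choose m)"
      using binomial_absorption[of m N] binomial_absorb_comp[of N m] by simp
    then have "real (Suc m) * real (N choose Suc m) = real (N - m) * real (N choose m)"
      by (metis of_nat_mult)
    moreover have "0 < real (N choose Suc m)"
      using True by simp
    ultimately have "real (Suc m) / real (N choose m) = real (N - m) / real (N choose Suc m)"
      using pos by (simp add: frac_eq_eq del: of_nat_Suc)
    moreover have "n - Suc m = N - m"
      using N by simp
    ultimately show ?thesis
      unfolding dt by (metis times_divide_eq_left times_divide_eq_right mult.commute)
  next
    \<comment> \<open>Here \<open>m = N\<close>: the remaining tail sum is empty and the factor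
      \<open>n - Suc m\<close> is zero.\<close>
    case False
    with assms N show ?thesis
      by (simp add: S_def)
  qed
  moreover have "real (Suc m) * descent_time n m =
      real (Suc m) * real (n choose Suc m) / real (N choose m) +
      real (Suc m) * (S (Suc m) / real (N choose m))"
    unfolding dt S by (simp add: add_divide_distrib distrib_left del: of_nat_Suc)
  ultimately show ?thesis
    using pos unfolding absorb by simp
qed

text \<open>Of the \<open>n\<close> flips, \<open>d\<close> lower the distance and the others raise
  it. The equation is \<open>descent_time_rec\<close> at \<open>d - 1\<close> rearranged; for
  \<open>d = n\<close> the out-of-range value at \<open>Suc n\<close> has coefficient zero.\<close>

lemma hitting_time_first_step:
  assumes "0 < d" "d \<le> n"
  shows "hitting_time n d =
    1 + (real d * hitting_time n (d - 1) + real (n - d) * hitting_time n (Suc d)) / real n"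
proof -
  obtain m where m: "d = Suc m"
    using assms by (cases d) auto
  have "real (Suc m) * descent_time n m = real n + real (n - Suc m) * descent_time n (Suc m)"
    using assms m by (intro descent_time_rec) simp
  moreover have "real (n - Suc m) = real n - real (Suc m)"
    using assms m by (simp add: of_nat_diff)
  ultimately have "real n * hitting_time n (Suc m) =
      real n + (real (Suc m) * hitting_time n m + real (n - Suc m) * hitting_time n (Suc (Suc m)))"
    unfolding hitting_time_Suc by (simp add: algebra_simps del: of_nat_Suc)
  then show ?thesis
    using assms m by (simp add: field_simps del: of_nat_Suc)
qed

text \<open>\<open>hitting_time\<close> of the distance to \<open>j\<close> solves the first-step
  equations and, being monotone, is bounded by its value at the largest distance
  \<open>n\<close>.\<close>

lemma mean_first_passage_time_cube:
  assumes "0 < n" and i: "i \<in> verts (cube n)" and j: "j \<in> verts (cube n)"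
  shows "mean_first_passage_time (cube n) i j = ennreal (hitting_time n (card (diff_coords n i j)))"
proof (rule mean_first_passage_time_eqI[where V = "verts (cube n)"
      and h = "\<lambda>v. ennreal (hitting_time n (card (diff_coords n v j)))" and M = "ennreal (hitting_time n n)"])
  fix v assume v: "v \<in> verts (cube n)"
  show "finite (nbrs (cube n) v) \<and> nbrs (cube n) v \<noteq> {} \<and> nbrs (cube n) v \<subseteq> verts (cube n)"
    using \<open>0 < n\<close> v flip_in_verts_cube by (auto simp: nbrs_cube)
  show "ennreal (hitting_time n (card (diff_coords n v j))) \<le> ennreal (hitting_time n n)"
    by (intro ennreal_leI hitting_time_mono card_diff_coords_le)
  assume "v \<noteq> j"
  let ?D = "diff_coords n v j"
  let ?d = "card ?D"
  have D: "?D \<subseteq> {1..n}"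
    by (auto simp: diff_coords_def)
  have d: "0 < ?d" "?d \<le> n"
    using diff_coords_eq_empty_iff[OF v j] \<open>v \<noteq> j\<close> card_diff_coords_le
    by (auto simp: card_gt_0_iff finite_diff_coords)
  have "(\<Sum>w\<in>nbrs (cube n) v. hitting_time n (card (diff_coords n w j))) =
      (\<Sum>l\<in>{1..n}. hitting_time n (card (diff_coords n (flip l v) j)))"
    by (simp add: nbrs_cube[OF v] sum.reindex[OF inj_on_subset[OF inj_flip]])
  \<comment> \<open>A flip in \<open>?D\<close> repairs a differing coordinate, any other flip
    creates a new one.\<close>
  also have "\<dots> = (\<Sum>l\<in>{1..n}. if l \<in> ?D then hitting_time n (?d - 1) else hitting_time n (Suc ?d))"
    by (rule sum.cong) (simp_all add: diff_coords_flip[OF v j] finite_diff_coords)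
  also have "\<dots> = real ?d * hitting_time n (?d - 1) + real (n - ?d) * hitting_time n (Suc ?d)"
  proof -
    have "{1..n} \<inter> {l. l \<in> ?D} = ?D" "{1..n} \<inter> - {l. l \<in> ?D} = {1..n} - ?D"
      using D by auto
    moreover have "card ({1..n} - ?D) = n - ?d"
      using D by (simp add: card_Diff_subset finite_diff_coords)
    ultimately show ?thesis
      by (simp only: sum.If_cases[OF finite_atLeastAtMost] sum_constant)
  qed
  finally have sum: "(\<Sum>w\<in>nbrs (cube n) v. hitting_time n (card (diff_coords n w j))) =
      real ?d * hitting_time n (?d - 1) + real (n - ?d) * hitting_time n (Suc ?d)" .
  have "hitting_time n ?d =
      1 + (\<Sum>w\<in>nbrs (cube n) v. hitting_time n (card (diff_coords n w j))) / real (card (nbrs (cube n) v))"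
    unfolding sum card_nbrs_cube[OF v] by (rule hitting_time_first_step[OF d])
  then show "ennreal (hitting_time n ?d) = 1 +
      (\<Sum>w\<in>nbrs (cube n) v. ennreal (hitting_time n (card (diff_coords n w j)))) /
      of_nat (card (nbrs (cube n) v))"
    using \<open>0 < n\<close> by (simp add: card_nbrs_cube[OF v] sum_ennreal hitting_time_nonneg sum_nonneg
        divide_ennreal ennreal_of_nat_eq_real_of_nat flip: ennreal_1 ennreal_plus)
next
  show "ennreal (hitting_time n (card (diff_coords n j j))) = 0"
    by (simp add: diff_coords_def hitting_time_def)
qed (use i in auto)

text \<open>Seen from any start, the difference sets run through all subsets of
  \<open>{1..n}\<close> exactly once, so the average is the same for every start.\<close>

lemma eigentime_cube:
  assumes "0 < n"
  shows "eigentime (cube n) = ennreal ((\<Sum>A\<in>Pow {1..n}. hitting_time n (card A)) / 2 ^ n)"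
proof -
  let ?h = "ennreal ((\<Sum>A\<in>Pow {1..n}. hitting_time n (card A)) / 2 ^ n)"
  have eq: "(\<Sum>j\<in>verts (cube n). ennreal (stationary (cube n) j) * mean_first_passage_time (cube n) i j) = ?h"
    if i: "i \<in> verts (cube n)" for i
  proof -
    have "(\<Sum>j\<in>verts (cube n). ennreal (stationary (cube n) j) * mean_first_passage_time (cube n) i j) =
        (\<Sum>j\<in>verts (cube n). ennreal (hitting_time n (card (diff_coords n i j)) / 2 ^ n))"
      using assms by (intro sum.cong)
        (simp_all add: stationary_cube mean_first_passage_time_cube i hitting_time_nonneg flip: ennreal_mult)
    also have "\<dots> = (\<Sum>A\<in>Pow {1..n}. ennreal (hitting_time n (card A) / 2 ^ n))"
      by (rule sum.reindex_bij_betw[OF bij_betw_diff_coords[OF i]])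
    also have "\<dots> = ?h"
      by (simp add: sum_ennreal hitting_time_nonneg sum_divide_distrib)
    finally show ?thesis .
  qed
  have "verts (cube n) \<noteq> {}"
    using card_verts_cube[of n] by auto
  with eq show ?thesis
    unfolding eigentime_def by (intro the_equality) auto
qed

section \<open>Asymptotics of the average hitting time\<close>

lemma descent_time_le:
  assumes "m < n"
  shows "descent_time n m \<le> 2 ^ n / real ((n - 1) choose m)"
proof -
  have "(\<Sum>l=Suc m..n. real (n choose l)) \<le> (\<Sum>l\<le>n. real (n choose l))"
    by (rule sum_mono2) auto
  also have "\<dots> = 2 ^ n"
    by (metis choose_row_sum of_nat_numeral of_nat_power of_nat_sum)
  finally show ?thesis
    unfolding descent_time_def by (intro divide_right_mono) auto
qed

lemma descent_time_0: "0 < n \<Longrightarrow> descent_time n 0 = 2 ^ n - 1"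
proof -
  assume "0 < n"
  have "(\<Sum>l\<le>n. real (n choose l)) = 2 ^ n"
    by (metis choose_row_sum of_nat_numeral of_nat_power of_nat_sum)
  then show ?thesis
    by (simp add: descent_time_def atMost_atLeast0 sum.atLeast_Suc_atMost)
qed

text \<open>Binomial coefficients increase up to the middle; beyond it, symmetry reflects
  \<open>m\<close> to \<open>n - m\<close>, which is still at least 2.\<close>

lemma choose_2_le_choose:
  assumes "2 \<le> m" "m + 2 \<le> n"
  shows "n choose 2 \<le> n choose m"
proof (cases "2 * m \<le> n")
  case True
  with assms show ?thesis
    by (intro binomial_mono)
next
  case False
  then have "n choose 2 \<le> n choose (n - m)"
    using assms by (intro binomial_mono) auto
  then show ?thesis
    using assms binomial_symmetric[of m n] by simp
qed

text \<open>The denominators \<open>N choose m\<close> are at least \<open>N choose 2\<close> except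
  at \<open>m = 0, 1, N - 1, N\<close>, so the generic terms contribute only
  \<open>2 ^ Suc N * O(1 / N)\<close>.\<close>

lemma hitting_time_le:
  assumes "3 \<le> N"
  shows "hitting_time (Suc N) (Suc N) \<le>
    2 ^ Suc N * (1 + 1 / 2 ^ Suc N + 2 / real N + real (Suc N) / (real N * (real N - 1) / 2))"
proof -
  let ?c = "real N * (real N - 1) / 2"
  have c: "real (N choose 2) = ?c"
    using assms by (simp add: choose_two real_of_nat_div of_nat_diff)
  \<comment> \<open>The four exceptional values of \<open>m\<close> get their own terms; the generic
    bound \<open>1 / ?c\<close> is kept for every \<open>m\<close>, which makes the sum easy to
    evaluate.\<close>
  let ?b = "\<lambda>m. (if m = 0 then 1 else 0) + (if m = N then 1 / 2 ^ Suc N else 0) +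
    (if m = 1 then 1 / real N else 0) + (if m = N - 1 then 1 / real N else 0) + 1 / ?c"
  have "descent_time (Suc N) m \<le> 2 ^ Suc N * ?b m" if "m < Suc N" for m
  proof -
    have cpos: "0 < ?c"
      using assms by simp
    have le: "descent_time (Suc N) m \<le> 2 ^ Suc N * (1 / real (N choose m))"
      using descent_time_le[OF that] by simp
    have "m = 0 \<or> m = N \<or> m = 1 \<or> m = N - 1 \<or> (2 \<le> m \<and> m + 2 \<le> N)"
      using that by linarith
    then consider "m = N" | "m = N - 1" | "2 \<le> m" "m + 2 \<le> N" | "m = 0 \<or> m = 1"
      by blast
    then show ?thesis
    proof cases
      case 1
      \<comment> \<open>The bound \<open>descent_time_le\<close> is too weak here, since the
        denominator is 1; but the tail sum is the single term 1.\<close>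
      then have "descent_time (Suc N) m = 2 ^ Suc N * (1 / 2 ^ Suc N)"
        by (simp add: descent_time_def)
      also have "\<dots> \<le> 2 ^ Suc N * ?b m"
        using 1 cpos by (intro mult_left_mono) auto
      finally show ?thesis .
    next
      case 2
      then have "N choose m = N"
        using assms binomial_symmetric[of 1 N] by simp
      then have "1 / real (N choose m) \<le> ?b m"
        using 2 cpos by auto
      with le show ?thesis
        by (meson mult_left_mono order_trans zero_le_numeral zero_le_power)
    next
      case 3
      have "1 / real (N choose m) \<le> 1 / ?c"
        using choose_2_le_choose[OF 3] cpos unfolding c[symmetric] by (intro frac_le) auto
      also have "\<dots> \<le> ?b m"
        by auto
      finally show ?thesis
        using le by (meson mult_left_mono order_trans zero_le_numeral zero_le_power)
    next
      case 4
      then have "1 / real (N choose m) \<le> ?b m"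
        using assms cpos by auto
      with le show ?thesis
        by (meson mult_left_mono order_trans zero_le_numeral zero_le_power)
    qed
  qed
  then have "hitting_time (Suc N) (Suc N) \<le> (\<Sum>m<Suc N. 2 ^ Suc N * ?b m)"
    unfolding hitting_time_def by (intro sum_mono) auto
  also have "\<dots> = 2 ^ Suc N * (\<Sum>m<Suc N. ?b m)"
    by (rule sum_distrib_left[symmetric])
  also have "(\<Sum>m<Suc N. ?b m) = 1 + 1 / 2 ^ Suc N + 2 / real N + real (Suc N) / ?c"
    using assms by (simp only: sum.distrib sum.delta finite_lessThan) simp
  finally show ?thesis .
qed

lemma hitting_time_average_tendsto:
  "(\<lambda>n. (\<Sum>A\<in>Pow {1..n}. hitting_time n (card A)) / 2 ^ n / 2 ^ n) \<longlonglongrightarrow> 1"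
proof (rule LIMSEQ_imp_Suc, rule tendsto_sandwich)
  let ?avg = "\<lambda>N. (\<Sum>A\<in>Pow {1..Suc N}. hitting_time (Suc N) (card A)) / 2 ^ Suc N / 2 ^ Suc N"
  \<comment> \<open>One factor \<open>2 ^ Suc N - 1\<close> counts the nonempty difference sets, the
    other is the hitting time from distance 1.\<close>
  let ?lo = "\<lambda>N. (2 ^ Suc N - 1) * (2 ^ Suc N - 1) / 2 ^ Suc N / 2 ^ Suc N :: real"
  let ?up = "\<lambda>N. 1 + 1 / 2 ^ Suc N + 2 / real N + real (Suc N) / (real N * (real N - 1) / 2)"
  show "?lo \<longlonglongrightarrow> 1" "?up \<longlonglongrightarrow> 1"
    by real_asymp+
  show "\<forall>\<^sub>F N in sequentially. ?lo N \<le> ?avg N"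
  proof (rule always_eventually, rule allI)
    fix N
    let ?n = "Suc N"
    have "(2 ^ ?n - 1) * (2 ^ ?n - 1) = (\<Sum>A\<in>Pow {1..?n} - {{}}. hitting_time ?n 1)"
      by (simp add: card_Pow hitting_time_def descent_time_0 of_nat_diff)
    also have "\<dots> \<le> (\<Sum>A\<in>Pow {1..?n} - {{}}. hitting_time ?n (card A))"
    proof (intro sum_mono hitting_time_mono)
      fix A assume "A \<in> Pow {1..?n} - {{}}"
      then show "1 \<le> card A"
        by (auto simp: Suc_le_eq card_gt_0_iff intro: finite_subset)
    qed
    also have "\<dots> \<le> (\<Sum>A\<in>Pow {1..?n}. hitting_time ?n (card A))"
      by (rule sum_mono2) (auto simp: hitting_time_nonneg)
    finally show "?lo N \<le> ?avg N"
      by (intro divide_right_mono) auto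
  qed
  show "\<forall>\<^sub>F N in sequentially. ?avg N \<le> ?up N"
    using eventually_ge_at_top[of 3]
  proof eventually_elim
    case (elim N)
    let ?n = "Suc N"
    have "(\<Sum>A\<in>Pow {1..?n}. hitting_time ?n (card A)) \<le> (\<Sum>A\<in>Pow {1..?n}. hitting_time ?n ?n)"
    proof (intro sum_mono hitting_time_mono)
      fix A assume "A \<in> Pow {1..?n}"
      then show "card A \<le> ?n"
        using card_mono[of "{1..?n}" A] by simp
    qed
    also have "\<dots> = 2 ^ ?n * hitting_time ?n ?n"
      by (simp add: card_Pow)
    also have "\<dots> \<le> 2 ^ ?n * (2 ^ ?n * ?up N)"
      using hitting_time_le[OF elim] by (intro mult_left_mono) auto
    finally show "?avg N \<le> ?up N"
      by (simp only: divide_le_eq zero_less_power zero_less_numeral mult_ac if_True)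
  qed
qed

theorem proposition4p2:
  shows "(\<lambda>n. eigentime (cube n) / 2 ^ n) \<longlonglongrightarrow> 1"
proof -
  have "(\<lambda>n. ennreal ((\<Sum>A\<in>Pow {1..n}. hitting_time n (card A)) / 2 ^ n / 2 ^ n)) \<longlonglongrightarrow> ennreal 1"
    by (intro tendsto_ennrealI hitting_time_average_tendsto)
  \<comment> \<open>Only eventually, because \<open>eigentime_cube\<close> requires a positive
    dimension.\<close>
  moreover have "\<forall>\<^sub>F n in sequentially. eigentime (cube n) / 2 ^ n =
      ennreal ((\<Sum>A\<in>Pow {1..n}. hitting_time n (card A)) / 2 ^ n / 2 ^ n)"
    using eventually_gt_at_top[of 0]
  proof eventually_elim
    case (elim n)
    have "(2 :: ennreal) ^ n = ennreal (2 ^ n)"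
      by (metis ennreal_numeral ennreal_power zero_le_numeral)
    with elim show ?case
      by (simp add: eigentime_cube divide_ennreal sum_nonneg hitting_time_nonneg)
  qed
  ultimately show ?thesis
    by (simp add: tendsto_cong)
qed

end
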